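(* Let $a<b$ be real numbers, let $f:[a,b]\to\mathbb{R}$ be twice differentiable on $[a,b]$, and let $m_2,M_2\in\mathbb{R}$ satisfy $m_2\le f''(x)\le M_2$ for all $x\in[a,b]$. Then $$\left|\int_a^b f(x)\,dx-(b-a)\frac{f(a)+f(b)}{2}+\frac{(b-a)^2\,(f'(b)-f'(a))}{12}\right|\le\frac{(b-a)^3}{48}(M_2-m_2).$$
   Context: At the endpoints $a$ and $b$, derivatives are understood as one-sided derivatives. *)

theory Defs
  imports "HOL-Analysis.Analysis"
begin

end

theory Submission
  imports Defs
begin

text \<open>
  Let \<open>c\<close> be the midpoint and \<open>h\<close> the half-length of the interval, and put
  \<open>K x = (x - c)\<^sup>2 / 2 - h\<^sup>2 / 6\<close>.  Since \<open>K'' = 1\<close>, \<open>K' = -h\<close> at \<open>a\<close>, \<open>K' = h\<close> at \<open>b\<close> and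
  \<open>K = h\<^sup>2 / 3 = (b - a)\<^sup>2 / 12\<close> at both, integrating by parts twice turns the quantity inside
  the absolute value into \<open>\<integral> K f''\<close>.  The constant in \<open>K\<close> is such that \<open>\<integral> K = 0\<close>, so \<open>f''\<close>
  may be replaced by its deviation from \<open>(m2 + M2) / 2\<close>, which is at most \<open>(M2 - m2) / 2\<close>.
  It remains to see that \<open>\<integral> \<bar>K\<bar> \<le> h ^ 3 / 3\<close>.  The arithmetic-geometric mean inequality bounds
  \<open>\<bar>K\<bar>\<close> by a polynomial whose integral is \<open>3 / 10 * h ^ 3\<close> (\<open>abs_kernel_le\<close>), which is
  enough and avoids splitting the interval at the roots of \<open>K\<close>.

  A bounded second derivative can fail to be Riemann integrable, as Volterra's example shows,
  so no integral of \<open>f''\<close> is formed: the integrals above stand for increments of explicit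
  antiderivatives, and the mean value inequality \<open>differentiable_bound_general\<close> compares these.
\<close>

text \<open>
  This is \<open>2 * \<bar>k\<bar> \<le> k\<^sup>2 / l + l\<close> for \<open>k = t\<^sup>2 / 2 - h\<^sup>2 / 6\<close> and \<open>l = h\<^sup>2 / 6\<close>.  The best \<open>l\<close>
  would be the root mean square of \<open>k\<close> over \<open>[-h, h]\<close>, that is \<open>h\<^sup>2 / sqrt 45\<close>; \<open>h\<^sup>2 / 6\<close> is
  a rational value close to it.
\<close>

lemma abs_kernel_le:
  fixes t h :: real
  assumes "h \<noteq> 0"
  shows "\<bar>t\<^sup>2 / 2 - h\<^sup>2 / 6\<bar> \<le> 3 * t ^ 4 / (4 * h\<^sup>2) - t\<^sup>2 / 2 + h\<^sup>2 / 6"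
proof -
  define k where "k = t\<^sup>2 / 2 - h\<^sup>2 / 6"
  have pos: "h\<^sup>2 > 0" using assms by simp
  have "0 \<le> 3 / h\<^sup>2 * (\<bar>k\<bar> - h\<^sup>2 / 6)\<^sup>2" by simp
  also have "\<dots> = 3 * k\<^sup>2 / h\<^sup>2 + h\<^sup>2 / 12 - \<bar>k\<bar>"
    using pos by (simp add: power2_diff field_simps)
  also have "3 * k\<^sup>2 / h\<^sup>2 + h\<^sup>2 / 12 = 3 * t ^ 4 / (4 * h\<^sup>2) - t\<^sup>2 / 2 + h\<^sup>2 / 6"
    using assms unfolding k_def
    by (simp add: power2_diff field_simps)
  finally show ?thesis by (simp add: k_def)
qed

theorem lemma3p4:
  fixes a b m2 M2 :: real and f f' f'' :: "real \<Rightarrow> real"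
  assumes "a < b"
    and "\<And>x. x \<in> {a..b} \<Longrightarrow> (f has_real_derivative f' x) (at x within {a..b})"
    and "\<And>x. x \<in> {a..b} \<Longrightarrow> (f' has_real_derivative f'' x) (at x within {a..b})"
    and "\<And>x. x \<in> {a..b} \<Longrightarrow> m2 \<le> f'' x \<and> f'' x \<le> M2"
  shows "\<bar>integral {a..b} f - (b - a) * ((f a + f b) / 2)
            + (b - a)\<^sup>2 * (f' b - f' a) / 12\<bar>
         \<le> (b - a) ^ 3 / 48 * (M2 - m2)"
proof -
  define c where "c = (a + b) / 2"
  define h where "h = (b - a) / 2"
  define \<mu> where "\<mu> = (m2 + M2) / 2"
  define d where "d = (M2 - m2) / 2"
  have h: "h > 0" using \<open>a < b\<close> by (simp add: h_def)
  have "m2 \<le> M2" using assms(4)[of a] \<open>a < b\<close> by simp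
  then have d: "d \<ge> 0" by (simp add: d_def)
  have ends: "a = c - h" "b = c + h" by (simp_all add: c_def h_def field_simps)
  define K where "K = (\<lambda>x. (x - c)\<^sup>2 / 2 - h\<^sup>2 / 6)"
  \<comment> \<open>An antiderivative of \<open>K * (f'' - \<mu>)\<close>; the last term, which accounts for \<open>\<mu>\<close>,
      vanishes at both endpoints.\<close>
  define \<Phi> where "\<Phi> = (\<lambda>x. integral {a..x} f - (x - c) * f x + K x * f' x
                            - \<mu> * ((x - c) ^ 3 / 6 - h\<^sup>2 * (x - c) / 6))"
  \<comment> \<open>An antiderivative of \<open>d\<close> times the bound for \<open>\<bar>K\<bar>\<close>.\<close>
  define \<Psi> where "\<Psi> = (\<lambda>x. d * (3 * (x - c) ^ 5 / (20 * h\<^sup>2) - (x - c) ^ 3 / 6 + h\<^sup>2 * (x - c) / 6))"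
  have contf: "continuous_on {a..b} f"
    by (rule DERIV_continuous_on[OF assms(2)])
  have D\<Phi>: "(\<Phi> has_real_derivative K x * (f'' x - \<mu>)) (at x within {a..b})"
    if x: "x \<in> {a..b}" for x
  proof -
    have "((\<lambda>u. integral {a..u} f) has_real_derivative f x) (at x within {a..b})"
      by (rule integral_has_real_derivative[OF contf x])
    then show ?thesis
      unfolding \<Phi>_def K_def using h
      by (auto intro!: derivative_eq_intros assms(2,3)[OF x] simp: field_simps power2_eq_square)
  qed
  have D\<Psi>: "(\<Psi> has_real_derivative
        d * (3 * (x - c) ^ 4 / (4 * h\<^sup>2) - (x - c)\<^sup>2 / 2 + h\<^sup>2 / 6)) (at x within S)" for x S
    unfolding \<Psi>_def using h
    by (auto intro!: derivative_eq_intros simp: field_simps)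
  have "norm (\<Phi> b - \<Phi> a) \<le> \<Psi> b - \<Psi> a"
  proof (rule differentiable_bound_general[OF \<open>a < b\<close>])
    show "continuous_on {a..b} \<Phi>" by (rule DERIV_continuous_on[OF D\<Phi>])
    show "continuous_on {a..b} \<Psi>" by (rule DERIV_continuous_on[OF D\<Psi>])
  next
    fix x assume x: "a < x" "x < b"
    then have "at x within {a..b} = at x"
      by (simp add: at_within_Icc_at)
    then show "(\<Phi> has_vector_derivative K x * (f'' x - \<mu>)) (at x)"
      using D\<Phi>[of x] x by (simp add: has_real_derivative_iff_has_vector_derivative)
    show "(\<Psi> has_vector_derivative
        d * (3 * (x - c) ^ 4 / (4 * h\<^sup>2) - (x - c)\<^sup>2 / 2 + h\<^sup>2 / 6)) (at x)"
      using D\<Psi> by (simp add: has_real_derivative_iff_has_vector_derivative)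
    have "\<bar>f'' x - \<mu>\<bar> \<le> d"
      unfolding \<mu>_def d_def abs_le_iff using assms(4)[of x] x by (simp add: field_simps)
    moreover have "\<bar>K x\<bar> \<le> 3 * (x - c) ^ 4 / (4 * h\<^sup>2) - (x - c)\<^sup>2 / 2 + h\<^sup>2 / 6"
      unfolding K_def using h by (intro abs_kernel_le) simp
    ultimately show "norm (K x * (f'' x - \<mu>))
        \<le> d * (3 * (x - c) ^ 4 / (4 * h\<^sup>2) - (x - c)\<^sup>2 / 2 + h\<^sup>2 / 6)"
      unfolding real_norm_def abs_mult using d by (subst mult.commute, intro mult_mono) auto
  qed
  moreover have "\<Phi> b - \<Phi> a = integral {a..b} f - (b - a) * ((f a + f b) / 2)
            + (b - a)\<^sup>2 * (f' b - f' a) / 12"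
  proof -
    have \<Phi>b: "\<Phi> b = integral {a..b} f - h * f b + h\<^sup>2 / 3 * f' b"
      by (simp add: \<Phi>_def K_def ends(2) power3_eq_cube power2_eq_square)
    have \<Phi>a: "\<Phi> a = h * f a + h\<^sup>2 / 3 * f' a"
      by (simp add: \<Phi>_def K_def ends(1) power3_eq_cube power2_eq_square)
    show ?thesis
      unfolding \<Phi>a \<Phi>b by (simp add: h_def field_simps power2_eq_square)
  qed
  moreover have "\<Psi> b - \<Psi> a = 3 / 10 * h ^ 3 * d"
    using h by (simp add: \<Psi>_def ends field_simps power_numeral_reduce)
  moreover have "3 / 10 * h ^ 3 * d \<le> h ^ 3 / 3 * d"
    using h d by (intro mult_right_mono) auto
  moreover have "h ^ 3 / 3 * d = (b - a) ^ 3 / 48 * (M2 - m2)"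
    by (simp add: h_def d_def power_divide)
  ultimately show ?thesis by (metis order_trans real_norm_def)
qed

end
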